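(* Let $R$ be a commutative ring, $M$ an $R$-module and $N$ a pure submodule of $M$. If $M$ is simple-direct-injective, then $N$ is simple-direct-injective. The converse is true if $\mathrm{soc}(M)\subseteq N$; that is, if $\mathrm{soc}(M)\subseteq N$ and $N$ is simple-direct-injective, then $M$ is simple-direct-injective.
   Context: Rings are associative with unity and modules are unitary. A module $M$ is simple-direct-injective if, whenever $A$ and $B$ are simple submodules of $M$ with $A\cong B$ and $B$ a direct summand of $M$, then $A$ is a direct summand of $M$. A submodule $A$ of $B$ is pure if for every $R$-module $L$ the map $A\otimes_R L\to B\otimes_R L$ induced by inclusion is a monomorphism. $\mathrm{soc}(M)$ is the sum of all simple submodules of $M$. *)

theory Defs
  imports "HOL-Algebra.Module" "HOL-Algebra.AbelCoset" "HOL-Algebra.Generated_Groups"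
    "HOL-Algebra.Free_Abelian_Groups"
begin

text \<open>The locale \<^locale>\<open>module\<close> already contains the assumption that the base ring is a
  commutative ring with unity and that the action is unitary. A submodule \<open>A\<close> of \<open>M\<close> is a set;
  regarded as a module in its own right it is \<open>M\<lparr>carrier := A\<rparr>\<close>.\<close>

section \<open>Simple-direct-injective modules\<close>

definition mod_hom ::
    "('r, 'x) ring_scheme \<Rightarrow> ('r, 'm, 'y) module_scheme \<Rightarrow> ('r, 'n, 'z) module_scheme \<Rightarrow> ('m \<Rightarrow> 'n) set"
  where "mod_hom R M N = {f \<in> carrier M \<rightarrow> carrier N.
     (\<forall>x\<in>carrier M. \<forall>y\<in>carrier M. f (x \<oplus>\<^bsub>M\<^esub> y) = f x \<oplus>\<^bsub>N\<^esub> f y) \<and>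
     (\<forall>r\<in>carrier R. \<forall>x\<in>carrier M. f (r \<odot>\<^bsub>M\<^esub> x) = r \<odot>\<^bsub>N\<^esub> f x)}"

definition mod_isomorphic ::
    "('r, 'x) ring_scheme \<Rightarrow> ('r, 'm, 'y) module_scheme \<Rightarrow> ('r, 'n, 'z) module_scheme \<Rightarrow> bool"
  where "mod_isomorphic R M N \<longleftrightarrow> (\<exists>f\<in>mod_hom R M N. bij_betw f (carrier M) (carrier N))"

definition simple_module :: "('r, 'x) ring_scheme \<Rightarrow> ('r, 'm, 'y) module_scheme \<Rightarrow> bool"
  where "simple_module R M \<longleftrightarrow> module R M \<and> carrier M \<noteq> {\<zero>\<^bsub>M\<^esub>} \<and>
     (\<forall>H. submodule H R M \<longrightarrow> H = {\<zero>\<^bsub>M\<^esub>} \<or> H = carrier M)"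

definition simple_submodule ::
    "('r, 'x) ring_scheme \<Rightarrow> ('r, 'm, 'y) module_scheme \<Rightarrow> 'm set \<Rightarrow> bool"
  where "simple_submodule R M A \<longleftrightarrow> submodule A R M \<and> simple_module R (M\<lparr>carrier := A\<rparr>)"

definition direct_summand ::
    "('r, 'x) ring_scheme \<Rightarrow> ('r, 'm, 'y) module_scheme \<Rightarrow> 'm set \<Rightarrow> bool"
  where "direct_summand R M A \<longleftrightarrow> submodule A R M \<and>
     (\<exists>B. submodule B R M \<and> A \<inter> B = {\<zero>\<^bsub>M\<^esub>} \<and> A <+>\<^bsub>M\<^esub> B = carrier M)"

definition simple_direct_injective ::
    "('r, 'x) ring_scheme \<Rightarrow> ('r, 'm, 'y) module_scheme \<Rightarrow> bool"
  where "simple_direct_injective R M \<longleftrightarrow>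
     (\<forall>A B. simple_submodule R M A \<and> simple_submodule R M B \<and>
        mod_isomorphic R (M\<lparr>carrier := A\<rparr>) (M\<lparr>carrier := B\<rparr>) \<and> direct_summand R M B
        \<longrightarrow> direct_summand R M A)"

text \<open>The sum of the family of all simple submodules: all finite sums of elements taken from
  pairwise distinct members of the family. It is zero if there is no simple submodule.\<close>

definition socle :: "('r, 'x) ring_scheme \<Rightarrow> ('r, 'm, 'y) module_scheme \<Rightarrow> 'm set"
  where "socle R M = {finsum M x F | x F.
     finite F \<and> (\<forall>A\<in>F. simple_submodule R M A \<and> x A \<in> A)}"

section \<open>Tensor products and purity\<close>

definition tensor_relators ::
    "('r, 'x) ring_scheme \<Rightarrow> ('r, 'm, 'y) module_scheme \<Rightarrow> ('r, 'l, 'z) module_scheme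
      \<Rightarrow> ('m \<times> 'l \<Rightarrow>\<^sub>0 int) set"
  where "tensor_relators R M L =
     {frag_of (x \<oplus>\<^bsub>M\<^esub> y, l) - frag_of (x, l) - frag_of (y, l) | x y l.
        x \<in> carrier M \<and> y \<in> carrier M \<and> l \<in> carrier L} \<union>
     {frag_of (x, k \<oplus>\<^bsub>L\<^esub> l) - frag_of (x, k) - frag_of (x, l) | x k l.
        x \<in> carrier M \<and> k \<in> carrier L \<and> l \<in> carrier L} \<union>
     {frag_of (r \<odot>\<^bsub>M\<^esub> x, l) - frag_of (x, r \<odot>\<^bsub>L\<^esub> l) | r x l.
        r \<in> carrier R \<and> x \<in> carrier M \<and> l \<in> carrier L}"

definition tensor_rel ::
    "('r, 'x) ring_scheme \<Rightarrow> ('r, 'm, 'y) module_scheme \<Rightarrow> ('r, 'l, 'z) module_scheme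
      \<Rightarrow> ('m \<times> 'l \<Rightarrow>\<^sub>0 int) set"
  where "tensor_rel R M L =
     generate (free_Abelian_group (carrier M \<times> carrier L)) (tensor_relators R M L)"

text \<open>Only the additive group of the tensor product is needed: a homomorphism of modules is a
  monomorphism iff it is injective, which does not refer to the action of the ring.\<close>

definition tensor_product ::
    "('r, 'x) ring_scheme \<Rightarrow> ('r, 'm, 'y) module_scheme \<Rightarrow> ('r, 'l, 'z) module_scheme
      \<Rightarrow> ('m \<times> 'l \<Rightarrow>\<^sub>0 int) set monoid"
  where "tensor_product R M L =
     free_Abelian_group (carrier M \<times> carrier L) Mod tensor_rel R M L"

text \<open>For \<open>f : A \<rightarrow> B\<close>, the map \<open>A \<otimes> L \<rightarrow> B \<otimes> L\<close> with \<open>a \<otimes> l \<mapsto> f a \<otimes> l\<close>, on cosets.\<close>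

definition tensor_map ::
    "('r, 'x) ring_scheme \<Rightarrow> ('r, 'b, 'y) module_scheme \<Rightarrow> ('r, 'l, 'z) module_scheme
      \<Rightarrow> ('a \<Rightarrow> 'b) \<Rightarrow> ('a \<times> 'l \<Rightarrow>\<^sub>0 int) set \<Rightarrow> ('b \<times> 'l \<Rightarrow>\<^sub>0 int) set"
  where "tensor_map R B L f X =
     tensor_rel R B L <#>\<^bsub>free_Abelian_group (carrier B \<times> carrier L)\<^esub>
       frag_extend (\<lambda>(a, l). frag_of (f a, l)) ` X"

text \<open>A formula cannot quantify over types, so \<open>L\<close> ranges over the modules carried by subsets of
  one fixed type, in which every finitely generated module over the ring has a copy. This is no
  restriction: \<open>pure_submodule_mon\<close> below derives the condition for modules \<open>L\<close> over any type.\<close>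

definition pure_submodule ::
    "('r, 'x) ring_scheme \<Rightarrow> ('r, 'm, 'y) module_scheme \<Rightarrow> 'm set \<Rightarrow> bool"
  where "pure_submodule R M A \<longleftrightarrow> submodule A R M \<and>
     (\<forall>L :: ('r, (nat \<Rightarrow> 'r) set) module. module R L \<longrightarrow>
        tensor_map R M L (\<lambda>a. a)
          \<in> mon (tensor_product R (M\<lparr>carrier := A\<rparr>) L) (tensor_product R M L))"

section \<open>Independence of the type of the test modules\<close>

lemma keys_frag_of_combination:
  "p \<in> S \<Longrightarrow> q \<in> S \<Longrightarrow> Poly_Mapping.keys (frag_of p - frag_of q) \<subseteq> S"
  "p \<in> S \<Longrightarrow> q \<in> S \<Longrightarrow> t \<in> S \<Longrightarrow> Poly_Mapping.keys (frag_of p - frag_of q - frag_of t) \<subseteq> S"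
proof -
  show 1: "Poly_Mapping.keys (frag_of p - frag_of q) \<subseteq> S" if "p \<in> S" "q \<in> S" for p q
    using keys_diff[of "frag_of p" "frag_of q"] that by auto
  show "Poly_Mapping.keys (frag_of p - frag_of q - frag_of t) \<subseteq> S" if "p \<in> S" "q \<in> S" "t \<in> S"
    using keys_diff[of "frag_of p - frag_of q" "frag_of t"] 1[OF that(1,2)] that(3) by auto
qed

lemma tensor_relators_intros:
  "\<lbrakk>x \<in> carrier M; y \<in> carrier M; l \<in> carrier L\<rbrakk> \<Longrightarrow>
    frag_of (x \<oplus>\<^bsub>M\<^esub> y, l) - frag_of (x, l) - frag_of (y, l) \<in> tensor_relators R M L"
  "\<lbrakk>x \<in> carrier M; k \<in> carrier L; l \<in> carrier L\<rbrakk> \<Longrightarrow>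
    frag_of (x, k \<oplus>\<^bsub>L\<^esub> l) - frag_of (x, k) - frag_of (x, l) \<in> tensor_relators R M L"
  "\<lbrakk>r \<in> carrier R; x \<in> carrier M; l \<in> carrier L\<rbrakk> \<Longrightarrow>
    frag_of (r \<odot>\<^bsub>M\<^esub> x, l) - frag_of (x, r \<odot>\<^bsub>L\<^esub> l) \<in> tensor_relators R M L"
  unfolding tensor_relators_def by blast+

lemma tensor_relators_carrier:
  assumes "module R M" "module R L"
  shows "tensor_relators R M L \<subseteq> carrier (free_Abelian_group (carrier M \<times> carrier L))"
proof -
  interpret M: module R M by fact
  interpret L: module R L by fact
  show ?thesis
    by (auto simp: tensor_relators_def simp del: keys_single
        dest!: subsetD[OF keys_frag_of_combination(1)[where S = "carrier M \<times> carrier L"], rotated 2]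
          subsetD[OF keys_frag_of_combination(2)[where S = "carrier M \<times> carrier L"], rotated 3])
qed

lemma tensor_rel_subgroup:
  assumes "module R M" "module R L"
  shows "subgroup (tensor_rel R M L) (free_Abelian_group (carrier M \<times> carrier L))"
  unfolding tensor_rel_def
  by (intro group.generate_is_subgroup tensor_relators_carrier assms) simp

lemma tensor_rel_normal:
  assumes "module R M" "module R L"
  shows "tensor_rel R M L \<lhd> free_Abelian_group (carrier M \<times> carrier L)"
  using tensor_rel_subgroup[OF assms] abelian_free_Abelian_group
  by (metis comm_group.normal_iff_subgroup)

lemma tensor_rel_induct [consumes 3, case_names zero relator minus add]:
  assumes "module R M" "module R L" "c \<in> tensor_rel R M L"
    and "P 0" "\<And>c. c \<in> tensor_relators R M L \<Longrightarrow> P c"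
    and "\<And>c. P c \<Longrightarrow> P (- c)" "\<And>c d. P c \<Longrightarrow> P d \<Longrightarrow> P (c + d)"
  shows "P c"
  using assms(3) unfolding tensor_rel_def
proof (induction rule: generate.induct)
  case (inv h)
  with tensor_relators_carrier[OF assms(1,2)]
  have "h \<in> carrier (free_Abelian_group (carrier M \<times> carrier L))" by blast
  then have "Poly_Mapping.keys h \<subseteq> carrier M \<times> carrier L" by simp
  with inv assms show ?case by simp
qed (use assms in auto)

lemma tensor_rel_zero: "module R M \<Longrightarrow> module R L \<Longrightarrow> 0 \<in> tensor_rel R M L"
  using subgroup.one_closed[OF tensor_rel_subgroup] by force

lemma tensor_rel_add:
  "module R M \<Longrightarrow> module R L \<Longrightarrow> c \<in> tensor_rel R M L \<Longrightarrow> d \<in> tensor_rel R M L \<Longrightarrow>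
    c + d \<in> tensor_rel R M L"
  using subgroup.m_closed[OF tensor_rel_subgroup] by force

lemma tensor_rel_keys:
  "module R M \<Longrightarrow> module R L \<Longrightarrow> c \<in> tensor_rel R M L \<Longrightarrow>
    Poly_Mapping.keys c \<subseteq> carrier M \<times> carrier L"
  using subgroup.subset[OF tensor_rel_subgroup] by force

lemma tensor_rel_minus:
  "module R M \<Longrightarrow> module R L \<Longrightarrow> c \<in> tensor_rel R M L \<Longrightarrow> - c \<in> tensor_rel R M L"
  using subgroup.m_inv_closed[OF tensor_rel_subgroup] tensor_rel_keys by force

lemma tensor_rel_relator: "c \<in> tensor_relators R M L \<Longrightarrow> c \<in> tensor_rel R M L"
  unfolding tensor_rel_def by (rule generate.incl)

lemma tensor_rel_map:
  assumes "module R M" "module R L" "module R N" "module R K"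
    and f: "f \<in> mod_hom R M N" and g: "g \<in> mod_hom R L K"
    and c: "c \<in> tensor_rel R M L"
  shows "frag_extend (\<lambda>(a, l). frag_of (f a, g l)) c \<in> tensor_rel R N K"
proof -
  have f': "f x \<in> carrier N" "f (x \<oplus>\<^bsub>M\<^esub> y) = f x \<oplus>\<^bsub>N\<^esub> f y" "r \<in> carrier R \<Longrightarrow> f (r \<odot>\<^bsub>M\<^esub> x) = r \<odot>\<^bsub>N\<^esub> f x"
    if "x \<in> carrier M" "y \<in> carrier M" for x y r
    using f that by (auto simp: mod_hom_def)
  have g': "g x \<in> carrier K" "g (x \<oplus>\<^bsub>L\<^esub> y) = g x \<oplus>\<^bsub>K\<^esub> g y" "r \<in> carrier R \<Longrightarrow> g (r \<odot>\<^bsub>L\<^esub> x) = r \<odot>\<^bsub>K\<^esub> g x"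
    if "x \<in> carrier L" "y \<in> carrier L" for x y r
    using g that by (auto simp: mod_hom_def)
  show ?thesis
    using assms(1,2) c
  proof (induction rule: tensor_rel_induct)
    case (relator c)
    then have "frag_extend (\<lambda>(a, l). frag_of (f a, g l)) c \<in> tensor_relators R N K"
      unfolding tensor_relators_def[of R M L]
      by (elim UnE CollectE exE conjE)
        (simp_all add: frag_extend_diff f' g' tensor_relators_intros)
    then show ?case by (rule tensor_rel_relator)
  qed (auto simp: frag_extend_minus frag_extend_add assms
        intro: tensor_rel_zero tensor_rel_minus tensor_rel_add)
qed

lemma submodule_module: "module R M \<Longrightarrow> submodule A R M \<Longrightarrow> module R (M\<lparr>carrier := A\<rparr>)"
  by (rule submodule.submodule_is_module)

lemma submodule_subset: "submodule A R M \<Longrightarrow> A \<subseteq> carrier M"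
  using subgroup.subset[OF submodule.axioms(1)] by force

lemma submodule_inclusion:
  "submodule A R M \<Longrightarrow> (\<lambda>a. a) \<in> mod_hom R (M\<lparr>carrier := A\<rparr>) M"
  using submodule_subset by (force simp: mod_hom_def)

lemma tensor_map_coset:
  assumes "module R A" "module R B" "module R L" "f \<in> mod_hom R A B"
    and c: "Poly_Mapping.keys c \<subseteq> carrier A \<times> carrier L"
  shows "tensor_map R B L f (tensor_rel R A L #>\<^bsub>free_Abelian_group (carrier A \<times> carrier L)\<^esub> c) =
     tensor_rel R B L #>\<^bsub>free_Abelian_group (carrier B \<times> carrier L)\<^esub>
       frag_extend (\<lambda>(a, l). frag_of (f a, l)) c"
proof -
  let ?g = "frag_extend (\<lambda>(a, l). frag_of (f a, l))"
  have id: "(\<lambda>l. l) \<in> mod_hom R L L" by (auto simp: mod_hom_def)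
  have g: "?g d \<in> tensor_rel R B L" if "d \<in> tensor_rel R A L" for d
    using tensor_rel_map[OF assms(1,3,2,3,4) id that] .
  show ?thesis
    unfolding tensor_map_def
  proof (intro Set.set_eqI iffI)
    fix z assume "z \<in> tensor_rel R B L <#>\<^bsub>free_Abelian_group (carrier B \<times> carrier L)\<^esub>
      ?g ` (tensor_rel R A L #>\<^bsub>free_Abelian_group (carrier A \<times> carrier L)\<^esub> c)"
    then obtain e d where e: "e \<in> tensor_rel R B L" and d: "d \<in> tensor_rel R A L"
      and z: "z = e + ?g (d + c)" by (auto simp: set_mult_def r_coset_def)
    then have "z = (e + ?g d) + ?g c" by (simp add: frag_extend_add add.assoc)
    with tensor_rel_add[OF assms(2,3) e g[OF d]]
    show "z \<in> tensor_rel R B L #>\<^bsub>free_Abelian_group (carrier B \<times> carrier L)\<^esub> ?g c"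
      by (auto simp: r_coset_def)
  next
    fix z assume "z \<in> tensor_rel R B L #>\<^bsub>free_Abelian_group (carrier B \<times> carrier L)\<^esub> ?g c"
    then obtain e where e: "e \<in> tensor_rel R B L" and z: "z = e + ?g (0 + c)"
      by (auto simp: r_coset_def)
    with tensor_rel_zero[OF assms(1,3)]
    show "z \<in> tensor_rel R B L <#>\<^bsub>free_Abelian_group (carrier B \<times> carrier L)\<^esub>
      ?g ` (tensor_rel R A L #>\<^bsub>free_Abelian_group (carrier A \<times> carrier L)\<^esub> c)"
      unfolding set_mult_def r_coset_def by (auto simp del: add_0)
  qed
qed

lemma tensor_map_hom:
  assumes "module R A" "module R B" "module R L" "f \<in> mod_hom R A B"
  shows "tensor_map R B L f \<in> hom (tensor_product R A L) (tensor_product R B L)"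
proof (rule homI)
  let ?FA = "free_Abelian_group (carrier A \<times> carrier L)"
  let ?FB = "free_Abelian_group (carrier B \<times> carrier L)"
  let ?g = "frag_extend (\<lambda>(a, l). frag_of (f a, l))"
  note nA = tensor_rel_normal[OF assms(1,3)] and nB = tensor_rel_normal[OF assms(2,3)]
  have keys: "Poly_Mapping.keys (?g c) \<subseteq> carrier B \<times> carrier L"
    if "Poly_Mapping.keys c \<subseteq> carrier A \<times> carrier L" for c
  proof (rule order_trans[OF keys_frag_extend UN_least])
    fix p assume "p \<in> Poly_Mapping.keys c"
    with that have "p \<in> carrier A \<times> carrier L" by (rule subsetD)
    then show "Poly_Mapping.keys (case p of (a, l) \<Rightarrow> frag_of (f a, l)) \<subseteq> carrier B \<times> carrier L"
      using assms(4) by (auto simp: mod_hom_def)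
  qed
  fix X assume X: "X \<in> carrier (tensor_product R A L)"
  then obtain c where c: "Poly_Mapping.keys c \<subseteq> carrier A \<times> carrier L"
    and Xc: "X = tensor_rel R A L #>\<^bsub>?FA\<^esub> c"
    by (auto simp: tensor_product_def carrier_FactGroup)
  show "tensor_map R B L f X \<in> carrier (tensor_product R B L)"
    using keys[OF c]
    by (auto simp: Xc tensor_map_coset[OF assms c] tensor_product_def carrier_FactGroup)
  fix Y assume Y: "Y \<in> carrier (tensor_product R A L)"
  then obtain d where d: "Poly_Mapping.keys d \<subseteq> carrier A \<times> carrier L"
    and Yd: "Y = tensor_rel R A L #>\<^bsub>?FA\<^esub> d"
    by (auto simp: tensor_product_def carrier_FactGroup)
  have cd: "Poly_Mapping.keys (c + d) \<subseteq> carrier A \<times> carrier L"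
    using keys_add[of c d] c d by auto
  have "X \<otimes>\<^bsub>tensor_product R A L\<^esub> Y = tensor_rel R A L #>\<^bsub>?FA\<^esub> (c + d)"
    using normal.rcos_sum[OF nA, of c d] c d by (simp add: tensor_product_def Xc Yd)
  moreover have "tensor_map R B L f X \<otimes>\<^bsub>tensor_product R B L\<^esub> tensor_map R B L f Y
      = tensor_rel R B L #>\<^bsub>?FB\<^esub> (?g c + ?g d)"
    using normal.rcos_sum[OF nB, of "?g c" "?g d"] keys[OF c] keys[OF d]
    by (simp add: tensor_product_def Xc Yd tensor_map_coset[OF assms c] tensor_map_coset[OF assms d])
  ultimately show "tensor_map R B L f (X \<otimes>\<^bsub>tensor_product R A L\<^esub> Y) =
      tensor_map R B L f X \<otimes>\<^bsub>tensor_product R B L\<^esub> tensor_map R B L f Y"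
    by (simp add: tensor_map_coset[OF assms cd] frag_extend_add)
qed

lemma frag_extend_inclusion [simp]: "frag_extend (\<lambda>(a, l). frag_of (a, l)) c = c"
  using frag_expansion[of c, symmetric] by (simp add: case_prod_unfold)

lemma tensor_map_mon_iff:
  fixes R :: "('r, 'x) ring_scheme" and M :: "('r, 'm, 'y) module_scheme"
    and L :: "('r, 'l, 'z) module_scheme"
  assumes M: "module R M" and A: "submodule A R M" and L: "module R L"
  shows "tensor_map R M L (\<lambda>a. a)
      \<in> mon (tensor_product R (M\<lparr>carrier := A\<rparr>) L) (tensor_product R M L) \<longleftrightarrow>
     (\<forall>c \<in> tensor_rel R M L. Poly_Mapping.keys c \<subseteq> A \<times> carrier L \<longrightarrow>
        c \<in> tensor_rel R (M\<lparr>carrier := A\<rparr>) L)"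
proof -
  let ?A = "M\<lparr>carrier := A\<rparr>"
  let ?FA = "free_Abelian_group (A \<times> carrier L)"
  let ?FM = "free_Abelian_group (carrier M \<times> carrier L)"
  let ?TA = "tensor_rel R ?A L" and ?TM = "tensor_rel R M L"
  note mA = submodule_module[OF M A]
  note sub = submodule_subset[OF A]
  have nA: "?TA \<lhd> ?FA" using tensor_rel_normal[OF mA L] by simp
  have nM: "?TM \<lhd> ?FM" using tensor_rel_normal[OF M L] by simp
  have sA: "subgroup ?TA ?FA" using tensor_rel_subgroup[OF mA L] by simp
  have sM: "subgroup ?TM ?FM" using tensor_rel_subgroup[OF M L] by simp
  have gA: "group (tensor_product R ?A L)" and gM: "group (tensor_product R M L)"
    unfolding tensor_product_def using normal.factorgroup_is_group[OF nA]
      normal.factorgroup_is_group[OF nM] by simp_all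
  have map: "tensor_map R M L (\<lambda>a. a) (?TA #>\<^bsub>?FA\<^esub> c) = ?TM #>\<^bsub>?FM\<^esub> c"
    if "Poly_Mapping.keys c \<subseteq> A \<times> carrier L" for c
    using tensor_map_coset[OF mA M L submodule_inclusion[OF A], of c] that by simp
  have oneA: "?TA #>\<^bsub>?FA\<^esub> c = ?TA \<longleftrightarrow> c \<in> ?TA" if "Poly_Mapping.keys c \<subseteq> A \<times> carrier L" for c
    using group.coset_join1[of ?FA ?TA c] group.coset_join2[of ?FA c ?TA] that sA by auto
  have oneM: "?TM #>\<^bsub>?FM\<^esub> c = ?TM \<longleftrightarrow> c \<in> ?TM"
    if "Poly_Mapping.keys c \<subseteq> carrier M \<times> carrier L" for c
    using group.coset_join1[of ?FM ?TM c] group.coset_join2[of ?FM c ?TM] that sM by auto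
  have keys: "Poly_Mapping.keys c \<subseteq> carrier M \<times> carrier L"
    if "Poly_Mapping.keys c \<subseteq> A \<times> carrier L" for c :: "'m \<times> 'l \<Rightarrow>\<^sub>0 int"
    using that sub by auto
  have "tensor_map R M L (\<lambda>a. a) \<in> mon (tensor_product R ?A L) (tensor_product R M L) \<longleftrightarrow>
      (\<forall>X. X \<in> carrier (tensor_product R ?A L) \<and>
        tensor_map R M L (\<lambda>a. a) X = \<one>\<^bsub>tensor_product R M L\<^esub> \<longrightarrow> X = \<one>\<^bsub>tensor_product R ?A L\<^esub>)"
    using mon_iff_hom_one[OF gA gM] tensor_map_hom[OF mA M L submodule_inclusion[OF A]] by blast
  also have "\<dots> \<longleftrightarrow> (\<forall>c. Poly_Mapping.keys c \<subseteq> A \<times> carrier L \<longrightarrow> c \<in> ?TM \<longrightarrow> c \<in> ?TA)"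
  proof -
    have carrier: "carrier (tensor_product R ?A L) =
        (\<lambda>c. ?TA #>\<^bsub>?FA\<^esub> c) ` {c. Poly_Mapping.keys c \<subseteq> A \<times> carrier L}"
      by (auto simp: tensor_product_def carrier_FactGroup)
    have one: "\<one>\<^bsub>tensor_product R M L\<^esub> = ?TM" "\<one>\<^bsub>tensor_product R ?A L\<^esub> = ?TA"
      by (simp_all add: tensor_product_def)
    have "(\<forall>X\<in>carrier (tensor_product R ?A L). tensor_map R M L (\<lambda>a. a) X = ?TM \<longrightarrow> X = ?TA) \<longleftrightarrow>
        (\<forall>c. Poly_Mapping.keys c \<subseteq> A \<times> carrier L \<longrightarrow> c \<in> ?TM \<longrightarrow> c \<in> ?TA)"
      unfolding carrier ball_simps by (simp add: map oneA oneM keys)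
    then show ?thesis unfolding one Ball_def by (simp only: imp_conjL)
  qed
  finally have eq: "tensor_map R M L (\<lambda>a. a) \<in> mon (tensor_product R ?A L) (tensor_product R M L) \<longleftrightarrow>
      (\<forall>c. Poly_Mapping.keys c \<subseteq> A \<times> carrier L \<longrightarrow> c \<in> ?TM \<longrightarrow> c \<in> ?TA)" .
  show ?thesis unfolding eq by (intro iffI ballI allI impI) simp_all
qed

lemma tensor_rel_finitary:
  assumes M: "module R M" and L: "module R L" and c: "c \<in> tensor_rel R M L"
  shows "\<exists>S. finite S \<and> S \<subseteq> carrier L \<and>
     (\<forall>H. submodule H R L \<longrightarrow> S \<subseteq> H \<longrightarrow> c \<in> tensor_rel R M (L\<lparr>carrier := H\<rparr>))"
  using M L c
proof (induction rule: tensor_rel_induct)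
  case zero
  show ?case using tensor_rel_zero[OF M submodule_module[OF L]] by (intro exI[of _ "{}"]) simp
next
  case (relator c)
  have *: ?case if S: "finite S" "S \<subseteq> carrier L"
    and H: "\<And>H. S \<subseteq> H \<Longrightarrow> c \<in> tensor_relators R M (L\<lparr>carrier := H\<rparr>)" for S
    using S H tensor_rel_relator by (intro exI[of _ S]) blast
  from relator show ?case
    unfolding tensor_relators_def
  proof (elim UnE CollectE exE conjE, goal_cases)
    case (1 x y l)
    show ?case
      using tensor_relators_intros(1)[of x M y l "L\<lparr>carrier := _\<rparr>" R] 1 by (intro *[of "{l}"]) simp_all
  next
    case (2 x k l)
    show ?case
      using tensor_relators_intros(2)[of x M k "L\<lparr>carrier := _\<rparr>" l R] 2 by (intro *[of "{k, l}"]) simp_all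
  next
    case (3 r x l)
    show ?case
      using tensor_relators_intros(3)[of r R x M l "L\<lparr>carrier := _\<rparr>"] 3 by (intro *[of "{l}"]) simp_all
  qed
next
  case (minus c)
  then obtain S where "finite S" "S \<subseteq> carrier L"
      "\<And>H. submodule H R L \<Longrightarrow> S \<subseteq> H \<Longrightarrow> c \<in> tensor_rel R M (L\<lparr>carrier := H\<rparr>)" by metis
  then show ?case
    using tensor_rel_minus[OF M submodule_module[OF L]] by (intro exI[of _ S]) simp
next
  case (add c d)
  then obtain S T where S: "finite S" "S \<subseteq> carrier L"
      "\<And>H. submodule H R L \<Longrightarrow> S \<subseteq> H \<Longrightarrow> c \<in> tensor_rel R M (L\<lparr>carrier := H\<rparr>)"
    and T: "finite T" "T \<subseteq> carrier L"
      "\<And>H. submodule H R L \<Longrightarrow> T \<subseteq> H \<Longrightarrow> d \<in> tensor_rel R M (L\<lparr>carrier := H\<rparr>)" by metis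
  show ?case
    using S T tensor_rel_add[OF M submodule_module[OF L]] by (intro exI[of _ "S \<union> T"]) auto
qed

lemma finite_subset_submodule:
  fixes R :: "('r, 'x) ring_scheme" and L :: "('r, 'l, 'y) module_scheme"
  assumes L: "module R L" and S: "finite S" "S \<subseteq> carrier L"
  shows "\<exists>H (e :: 'l \<Rightarrow> (nat \<Rightarrow> 'r) set). submodule H R L \<and> S \<subseteq> H \<and> inj_on e H"
proof -
  interpret L: module R L by fact
  obtain n and s :: "nat \<Rightarrow> 'l" where s: "S = s ` {..<n}"
    using finite_imp_nat_seg_image_inj_on[OF S(1)] by (auto simp: lessThan_def)
  have sc: "i < n \<Longrightarrow> s i \<in> carrier L" for i using s S by auto
  define C where "C = ({..<n} \<rightarrow> carrier R)"
  define \<phi> where "\<phi> r = (\<Oplus>\<^bsub>L\<^esub>i\<in>{..<n}. r i \<odot>\<^bsub>L\<^esub> s i)" for r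
  define H where "H = \<phi> ` C"
  define e where "e x = {r \<in> C. \<phi> r = x}" for x
  have \<phi>c: "\<phi> r \<in> carrier L" if "r \<in> C" for r
    using that sc by (auto simp: \<phi>_def C_def intro!: L.finsum_closed)
  have add: "\<phi> r \<oplus>\<^bsub>L\<^esub> \<phi> t = \<phi> (\<lambda>i. r i \<oplus>\<^bsub>R\<^esub> t i)" if "r \<in> C" "t \<in> C" for r t
  proof -
    have "\<phi> r \<oplus>\<^bsub>L\<^esub> \<phi> t = (\<Oplus>\<^bsub>L\<^esub>i\<in>{..<n}. r i \<odot>\<^bsub>L\<^esub> s i \<oplus>\<^bsub>L\<^esub> t i \<odot>\<^bsub>L\<^esub> s i)"
      unfolding \<phi>_def using that sc by (subst L.finsum_addf) (auto simp: C_def)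
    also have "\<dots> = \<phi> (\<lambda>i. r i \<oplus>\<^bsub>R\<^esub> t i)"
      unfolding \<phi>_def using that sc
      by (intro L.finsum_cong') (auto simp: C_def L.smult_l_distr Pi_iff)
    finally show ?thesis .
  qed
  have smult: "a \<odot>\<^bsub>L\<^esub> \<phi> r = \<phi> (\<lambda>i. a \<otimes>\<^bsub>R\<^esub> r i)" if "a \<in> carrier R" "r \<in> C" for a r
  proof -
    have "a \<odot>\<^bsub>L\<^esub> \<phi> r = (\<Oplus>\<^bsub>L\<^esub>i\<in>{..<n}. a \<odot>\<^bsub>L\<^esub> (r i \<odot>\<^bsub>L\<^esub> s i))"
      unfolding \<phi>_def using that sc by (intro L.finsum_smult_ldistr) (auto simp: C_def)
    also have "\<dots> = \<phi> (\<lambda>i. a \<otimes>\<^bsub>R\<^esub> r i)"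
      unfolding \<phi>_def using that sc
      by (intro L.finsum_cong') (auto simp: C_def L.smult_assoc1 Pi_iff)
    finally show ?thesis .
  qed
  have sH: "s j \<in> H" if j: "j < n" for j
  proof -
    define r where "r i = (if i = j then \<one>\<^bsub>R\<^esub> else \<zero>\<^bsub>R\<^esub>)" for i
    have "\<phi> r = (\<Oplus>\<^bsub>L\<^esub>i\<in>{..<n}. if j = i then s i else \<zero>\<^bsub>L\<^esub>)"
      unfolding \<phi>_def r_def using sc by (intro L.finsum_cong') auto
    also have "\<dots> = s j" using j sc by (intro L.add.finprod_singleton) auto
    finally have "\<phi> r = s j" .
    moreover have "r \<in> C" by (simp add: C_def r_def)
    ultimately show ?thesis unfolding H_def by (metis imageI)
  qed
  have smH: "a \<odot>\<^bsub>L\<^esub> x \<in> H" if "a \<in> carrier R" "x \<in> H" for a x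
  proof -
    from that(2) obtain r where r: "r \<in> C" "x = \<phi> r" by (auto simp: H_def)
    then have "(\<lambda>i. a \<otimes>\<^bsub>R\<^esub> r i) \<in> C" using that(1) by (simp add: C_def Pi_iff)
    then show ?thesis unfolding r(2) smult[OF that(1) r(1)] H_def by (rule imageI)
  qed
  have "submodule H R L"
  proof (rule L.submoduleI)
    show sub: "H \<subseteq> carrier L" using \<phi>c by (auto simp: H_def)
    have ne: "\<phi> (\<lambda>_. \<zero>\<^bsub>R\<^esub>) \<in> H" unfolding H_def by (rule imageI) (simp add: C_def)
    show "\<zero>\<^bsub>L\<^esub> \<in> H"
      using smH[OF L.R.zero_closed ne] subsetD[OF sub ne] by simp
    show "\<ominus>\<^bsub>L\<^esub> x \<in> H" if "x \<in> H" for x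
      using smH[OF L.R.a_inv_closed[OF L.R.one_closed] that] subsetD[OF sub that]
        L.smult_l_minus[of "\<one>\<^bsub>R\<^esub>" x] by simp
    show "x \<oplus>\<^bsub>L\<^esub> y \<in> H" if "x \<in> H" "y \<in> H" for x y
    proof -
      from that obtain r t where r: "r \<in> C" "x = \<phi> r" and t: "t \<in> C" "y = \<phi> t"
        by (auto simp: H_def)
      then have "(\<lambda>i. r i \<oplus>\<^bsub>R\<^esub> t i) \<in> C" by (simp add: C_def Pi_iff)
      then show ?thesis unfolding r(2) t(2) add[OF r(1) t(1)] H_def by (rule imageI)
    qed
  qed (rule smH)
  moreover have "inj_on e H" by (auto simp: inj_on_def H_def e_def)
  moreover have "S \<subseteq> H" using sH s by auto
  ultimately show ?thesis by blast
qed

lemma module_copy: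
  fixes R :: "('r, 'x) ring_scheme" and L :: "('r, 'l, 'y) module_scheme"
  assumes L: "module R L" and e: "inj_on e (carrier L)"
  shows "\<exists>K :: ('r, 'k) module. module R K \<and> e ` carrier L = carrier K \<and> e \<in> mod_hom R L K
     \<and> inv_into (carrier L) e \<in> mod_hom R K L"
proof -
  interpret L: module R L by fact
  let ?i = "inv_into (carrier L) e"
  define K :: "('r, 'k) module" where "K = \<lparr>carrier = e ` carrier L,
     mult = (\<lambda>x y. x), one = e \<zero>\<^bsub>L\<^esub>, ring.zero = e \<zero>\<^bsub>L\<^esub>, ring.add = (\<lambda>x y. e (?i x \<oplus>\<^bsub>L\<^esub> ?i y)),
     smult = (\<lambda>r x. e (r \<odot>\<^bsub>L\<^esub> ?i x))\<rparr>"
  have i [simp]: "x \<in> carrier L \<Longrightarrow> ?i (e x) = x" for x using e by simp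
  have "abelian_group K"
  proof (rule abelian_groupI)
    fix x assume "x \<in> carrier K"
    then obtain a where a: "a \<in> carrier L" "x = e a" by (auto simp: K_def)
    then show "\<exists>y\<in>carrier K. y \<oplus>\<^bsub>K\<^esub> x = \<zero>\<^bsub>K\<^esub>"
      by (intro bexI[of _ "e (\<ominus>\<^bsub>L\<^esub> a)"]) (auto simp: K_def L.l_neg)
  qed (auto simp: K_def L.a_ac)
  then have "module R K"
    by (intro moduleI L.R.is_cring)
      (auto simp: K_def L.smult_l_distr L.smult_r_distr L.smult_assoc1)
  then show ?thesis
    by (intro exI[of _ K]) (auto simp: K_def mod_hom_def)
qed

theorem pure_submodule_mon:
  fixes R :: "('r, 'x) ring_scheme" and M :: "('r, 'm, 'y) module_scheme"
    and L :: "('r, 'l, 'z) module_scheme"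
  assumes M: "module R M" and A: "pure_submodule R M A" and L: "module R L"
  shows "tensor_map R M L (\<lambda>a. a)
    \<in> mon (tensor_product R (M\<lparr>carrier := A\<rparr>) L) (tensor_product R M L)"
proof -
  let ?A = "M\<lparr>carrier := A\<rparr>"
  have sA: "submodule A R M" using A by (simp add: pure_submodule_def)
  note mA = submodule_module[OF M sA]
  have idA: "(\<lambda>a. a) \<in> mod_hom R ?A ?A" and idM: "(\<lambda>a. a) \<in> mod_hom R M M"
    by (auto simp: mod_hom_def)
  show ?thesis
    unfolding tensor_map_mon_iff[OF M sA L]
  proof (intro ballI impI)
    fix c assume c: "c \<in> tensor_rel R M L" and keys: "Poly_Mapping.keys c \<subseteq> A \<times> carrier L"
    obtain S where S: "finite S" "S \<subseteq> carrier L"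
      "\<And>H. submodule H R L \<Longrightarrow> S \<subseteq> H \<Longrightarrow> c \<in> tensor_rel R M (L\<lparr>carrier := H\<rparr>)"
      using tensor_rel_finitary[OF M L c] by blast
    have "finite (S \<union> snd ` Poly_Mapping.keys c)" "S \<union> snd ` Poly_Mapping.keys c \<subseteq> carrier L"
      using S(1,2) keys by auto
    from finite_subset_submodule[OF L this]
    obtain H and e :: "'l \<Rightarrow> (nat \<Rightarrow> 'r) set" where H: "submodule H R L"
      "S \<union> snd ` Poly_Mapping.keys c \<subseteq> H" and e: "inj_on e H"
      by (elim exE conjE)
    let ?H = "L\<lparr>carrier := H\<rparr>"
    let ?i = "inv_into H e"
    note mH = submodule_module[OF L H(1)]
    have "inj_on e (carrier ?H)" using e by simp
    from module_copy[OF mH this]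
    obtain K :: "('r, (nat \<Rightarrow> 'r) set) module" where "module R K" "e ` carrier ?H = carrier K"
      "e \<in> mod_hom R ?H K" "inv_into (carrier ?H) e \<in> mod_hom R K ?H"
      by (elim exE conjE)
    then have K: "module R K" "e ` H = carrier K" "e \<in> mod_hom R ?H K" "?i \<in> mod_hom R K ?H"
      by simp_all
    let ?c = "frag_extend (\<lambda>(a, l). frag_of (a, e l)) c"
    have "c \<in> tensor_rel R M ?H" using S(3)[OF H(1)] H(2) by simp
    then have "?c \<in> tensor_rel R M K" by (rule tensor_rel_map[OF M mH M K(1) idM K(3)])
    moreover have "Poly_Mapping.keys ?c \<subseteq> A \<times> carrier K"
    proof (rule order_trans[OF keys_frag_extend UN_least])
      fix p assume p: "p \<in> Poly_Mapping.keys c"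
      with keys have "p \<in> A \<times> carrier L" by (rule subsetD)
      moreover have "snd p \<in> H" using p H(2) by blast
      ultimately show "Poly_Mapping.keys (case p of (a, l) \<Rightarrow> frag_of (a, e l)) \<subseteq> A \<times> carrier K"
        using K(2) by auto
    qed
    moreover have "tensor_map R M K (\<lambda>a. a) \<in> mon (tensor_product R ?A K) (tensor_product R M K)"
      using A K(1) by (simp add: pure_submodule_def)
    ultimately have "?c \<in> tensor_rel R ?A K"
      unfolding tensor_map_mon_iff[OF M sA K(1)] by simp
    then have "frag_extend (\<lambda>(a, l). frag_of (a, ?i l)) ?c \<in> tensor_rel R ?A ?H"
      by (rule tensor_rel_map[OF mA K(1) mA mH idA K(4)])
    also have "frag_extend (\<lambda>(a, l). frag_of (a, ?i l)) ?c
        = frag_extend ((\<lambda>(a, l). frag_of (a, ?i l)) \<circ> (\<lambda>(a, l). (a, e l))) c"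
      using frag_extend_compose[of "\<lambda>(a, l). frag_of (a, ?i l)" "\<lambda>(a, l). (a, e l)" c]
      by (simp add: o_def case_prod_unfold)
    also have "\<dots> = frag_extend frag_of c"
    proof (rule frag_extend_eq)
      fix p assume "p \<in> Poly_Mapping.keys c"
      then have "snd p \<in> H" using H(2) by blast
      with e show "((\<lambda>(a, l). frag_of (a, ?i l)) \<circ> (\<lambda>(a, l). (a, e l))) p = frag_of p"
        by (simp add: case_prod_unfold)
    qed
    also have "\<dots> = c" by (rule frag_expansion[symmetric])
    finally have "c \<in> tensor_rel R ?A ?H" .
    from tensor_rel_map[OF mA mH mA L idA submodule_inclusion[OF H(1)] this]
    show "c \<in> tensor_rel R ?A L" by simp
  qed
qed

end

theory Submission
  imports Defs
begin

text \<open>For a simple submodule \<open>A\<close> contained in the pure submodule \<open>N\<close>, being a direct summand of \<open>N\<close>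
  and of \<open>M\<close> are equivalent, and both implications follow at once. If \<open>A\<close> is a summand of \<open>M\<close>, the
  modular law makes it a summand of \<open>N\<close>. Conversely, let \<open>N = A \<oplus> B\<close>, and let \<open>K\<close> be the set of
  those \<open>x\<close> in \<open>M\<close> with \<open>x \<otimes> l = 0\<close> in \<open>M \<otimes> A\<close> for all \<open>l\<close> in \<open>A\<close>; it contains \<open>Ann(A) M\<close>. If \<open>a\<close>
  lies in \<open>A \<inter> K\<close>, then \<open>a \<otimes> a = 0\<close> in \<open>N \<otimes> A\<close> by purity; but for \<open>a \<noteq> 0\<close> the balanced map
  \<open>(r a + b, y) \<mapsto> r y\<close> sends \<open>(a, a)\<close> to \<open>a\<close>. So \<open>A\<close> meets \<open>K\<close> trivially, and since \<open>Ann(A)\<close> is a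
  maximal ideal, a submodule that is maximal among those containing \<open>K\<close> and avoiding \<open>A\<close> is a
  complement of \<open>A\<close>.\<close>

section \<open>Submodules of a submodule, and generators of simple modules\<close>

lemma submodule_restrict_iff:
  assumes "module R M" "submodule N R M"
  shows "submodule H R (M\<lparr>carrier := N\<rparr>) \<longleftrightarrow> submodule H R M \<and> H \<subseteq> N"
proof -
  interpret M: module R M by fact
  interpret N: module R "M\<lparr>carrier := N\<rparr>" using submodule_module[OF assms] .
  show ?thesis
    using submodule_subset[OF assms(2)] submodule_module[of R "M\<lparr>carrier := N\<rparr>" H, OF N.module_axioms]
      submodule_module[of R M H, OF assms(1)] submodule_subset[of H R "M\<lparr>carrier := N\<rparr>"]
      M.module_incl_imp_submodule[of H] N.module_incl_imp_submodule[of H]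
    by auto
qed

lemma set_add_restrict [simp]: "A <+>\<^bsub>M\<lparr>carrier := N\<rparr>\<^esub> B = A <+>\<^bsub>M\<^esub> B"
  by (simp add: set_add_defs)

lemma simple_submodule_restrict_iff:
  assumes "module R M" "submodule N R M"
  shows "simple_submodule R (M\<lparr>carrier := N\<rparr>) A \<longleftrightarrow> simple_submodule R M A \<and> A \<subseteq> N"
  by (auto simp: simple_submodule_def submodule_restrict_iff[OF assms])

text \<open>The multiples of \<open>a\<close> form a submodule of \<open>A\<close> that contains
  \<open>a\<close> and so is nonzero; simplicity makes it all of \<open>A\<close>. Below, this
  replaces elements of \<open>A\<close> by scalars and inverts scalars modulo the annihilator of
  \<open>A\<close>.\<close>

lemma simple_submodule_generated:
  assumes "module R M" "simple_submodule R M A" "a \<in> A" "a \<noteq> \<zero>\<^bsub>M\<^esub>" "y \<in> A"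
  obtains r where "r \<in> carrier R" "y = r \<odot>\<^bsub>M\<^esub> a"
proof -
  interpret M: module R M by fact
  have A: "submodule A R M" and simple: "\<And>H. submodule H R M \<Longrightarrow> H \<subseteq> A \<Longrightarrow> H = {\<zero>\<^bsub>M\<^esub>} \<or> H = A"
    using assms(1,2) submodule_restrict_iff[of R M A]
    by (auto simp: simple_submodule_def simple_module_def)
  note sub = submodule_subset[OF A]
  have a: "a \<in> carrier M" using sub assms(3) by auto
  let ?H = "(\<lambda>r. r \<odot>\<^bsub>M\<^esub> a) ` carrier R"
  have "submodule ?H R M"
  proof (rule M.submoduleI)
    show "\<zero>\<^bsub>M\<^esub> \<in> ?H" using a by (intro image_eqI[of _ _ "\<zero>\<^bsub>R\<^esub>"]) auto
    show "\<ominus>\<^bsub>M\<^esub> x \<in> ?H" if "x \<in> ?H" for x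
      using that a by (auto simp: M.smult_l_minus[symmetric])
    show "x \<oplus>\<^bsub>M\<^esub> y \<in> ?H" if "x \<in> ?H" "y \<in> ?H" for x y
      using that a by (auto simp: M.smult_l_distr[symmetric])
    show "r \<odot>\<^bsub>M\<^esub> x \<in> ?H" if "r \<in> carrier R" "x \<in> ?H" for r x
      using that a by (auto simp: M.smult_assoc1[symmetric])
  qed (use a in auto)
  moreover have "?H \<subseteq> A" using M.submoduleE(4)[OF A] assms(3) by auto
  moreover have "a \<in> ?H" using a by (intro image_eqI[of _ _ "\<one>\<^bsub>R\<^esub>"]) auto
  ultimately have "?H = A" using simple assms(4) by blast
  then show thesis using assms(5) that by blast
qed

section \<open>Vanishing tensors and balanced maps\<close>

text \<open>The half of the universal property of the tensor product that detects nonzero tensors. A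
  balanced map extends to a homomorphism \<open>h\<close> on the free abelian group; its kernel is a
  subgroup containing every relator, hence all of \<open>tensor_rel\<close>.\<close>

lemma tensor_rel_balanced_zero:
  fixes P (structure)
  assumes "module R M" "module R L" "abelian_group P"
    and closed: "\<And>x l. x \<in> carrier M \<Longrightarrow> l \<in> carrier L \<Longrightarrow> \<beta> x l \<in> carrier P"
    and add_l: "\<And>x y l. x \<in> carrier M \<Longrightarrow> y \<in> carrier M \<Longrightarrow> l \<in> carrier L \<Longrightarrow>
      \<beta> (x \<oplus>\<^bsub>M\<^esub> y) l = \<beta> x l \<oplus> \<beta> y l"
    and add_r: "\<And>x k l. x \<in> carrier M \<Longrightarrow> k \<in> carrier L \<Longrightarrow> l \<in> carrier L \<Longrightarrow>
      \<beta> x (k \<oplus>\<^bsub>L\<^esub> l) = \<beta> x k \<oplus> \<beta> x l"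
    and balanced: "\<And>r x l. r \<in> carrier R \<Longrightarrow> x \<in> carrier M \<Longrightarrow> l \<in> carrier L \<Longrightarrow>
      \<beta> (r \<odot>\<^bsub>M\<^esub> x) l = \<beta> x (r \<odot>\<^bsub>L\<^esub> l)"
    and xl: "x \<in> carrier M" "l \<in> carrier L" "frag_of (x, l) \<in> tensor_rel R M L"
  shows "\<beta> x l = \<zero>"
proof -
  interpret M: module R M by fact
  interpret L: module R L by fact
  interpret P: abelian_group P by fact
  let ?F = "free_Abelian_group (carrier M \<times> carrier L)"
  have "(\<lambda>(x, l). \<beta> x l) ` (carrier M \<times> carrier L) \<subseteq> carrier (add_monoid P)" using closed by auto
  then obtain h where h: "h \<in> hom ?F (add_monoid P)"
    and hf: "\<And>p. p \<in> carrier M \<times> carrier L \<Longrightarrow> h (frag_of p) = (\<lambda>(x, l). \<beta> x l) p"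
    using comm_group.free_Abelian_group_universal[OF P.a_comm_group] by metis
  interpret h: group_hom ?F "add_monoid P" h
    using h P.a_group by (simp add: group_hom_def group_hom_axioms_def)
  have diff: "h (c - d) = h c \<ominus> h d"
    if "Poly_Mapping.keys c \<subseteq> carrier M \<times> carrier L" "Poly_Mapping.keys d \<subseteq> carrier M \<times> carrier L"
    for c d
    using h.hom_mult[of c "- d"] h.hom_inv[of d] that
    by (simp add: a_minus_def a_inv_def)
  have keys2: "Poly_Mapping.keys (frag_of p - frag_of q) \<subseteq> carrier M \<times> carrier L"
    if "p \<in> carrier M \<times> carrier L" "q \<in> carrier M \<times> carrier L" for p q
    by (rule keys_frag_of_combination(1)) (use that in auto)
  have key1: "Poly_Mapping.keys (frag_of p) \<subseteq> carrier M \<times> carrier L"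
    if "p \<in> carrier M \<times> carrier L" for p
    using that by simp
  \<comment> \<open>This is the image of an additivity relator under \<open>h\<close>;
    \<open>minus_self\<close> does the same for the scalar relators.\<close>
  have zero: "(x \<oplus> y) \<ominus> x \<ominus> y = \<zero>" if "x \<in> carrier P" "y \<in> carrier P" for x y
    using that P.r_neg[of "x \<oplus> y"] by (simp add: a_minus_def P.a_assoc P.minus_add)
  have minus_self: "x \<ominus> x = \<zero>" if "x \<in> carrier P" for x
    using that by (simp add: a_minus_def P.r_neg)
  have "h c = \<zero>" if "c \<in> tensor_relators R M L" for c
    using that unfolding tensor_relators_def
    by (elim UnE CollectE exE conjE)
      (simp_all add: diff keys2 key1 hf add_l add_r balanced closed zero M.smult_closed L.smult_closed
        minus_self del: keys_single)
  then have "tensor_relators R M L \<subseteq> kernel ?F (add_monoid P) h"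
    using subsetD[OF tensor_relators_carrier[OF assms(1,2)]] by (intro subsetI) (simp add: kernel_def)
  from group.generate_subgroup_incl[OF _ this h.subgroup_kernel]
  have "tensor_rel R M L \<subseteq> kernel ?F (add_monoid P) h" by (simp add: tensor_rel_def)
  with xl(3) have "h (frag_of (x, l)) = \<zero>" by (auto simp: kernel_def)
  then show ?thesis using hf[of "(x, l)"] xl(1,2) by simp
qed

section \<open>Complements of a simple submodule\<close>

text \<open>Assumption \<open>ann\<close> makes M/K a vector space over the field R/Ann(A), in which
  A embeds because A \<inter> K is zero; so A has a complement there. The proof works with
  submodules of M directly, without forming the quotients.\<close>

lemma direct_summand_if_avoids:
  assumes "module R M" "simple_submodule R M A" "submodule K R M" "A \<inter> K = {\<zero>\<^bsub>M\<^esub>}"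
    and ann: "\<And>r x. r \<in> carrier R \<Longrightarrow> (\<And>a. a \<in> A \<Longrightarrow> r \<odot>\<^bsub>M\<^esub> a = \<zero>\<^bsub>M\<^esub>) \<Longrightarrow>
      x \<in> carrier M \<Longrightarrow> r \<odot>\<^bsub>M\<^esub> x \<in> K"
  shows "direct_summand R M A"
proof -
  interpret M: module R M by fact
  have A: "submodule A R M" using assms(2) by (simp add: simple_submodule_def)
  note subA = submodule_subset[OF A]
  let ?\<A> = "{C. submodule C R M \<and> K \<subseteq> C \<and> A \<inter> C = {\<zero>\<^bsub>M\<^esub>}}"
  have "\<exists>C\<in>?\<A>. \<forall>X\<in>?\<A>. C \<subseteq> X \<longrightarrow> X = C"
  proof (rule subset_Zorn_nonempty)
    show "?\<A> \<noteq> {}" using assms by blast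
    fix \<C> assume ne: "\<C> \<noteq> {}" and ch: "subset.chain ?\<A> \<C>"
    then have C: "\<And>C. C \<in> \<C> \<Longrightarrow> submodule C R M \<and> K \<subseteq> C \<and> A \<inter> C = {\<zero>\<^bsub>M\<^esub>}"
      and lin: "\<And>C D. C \<in> \<C> \<Longrightarrow> D \<in> \<C> \<Longrightarrow> C \<subseteq> D \<or> D \<subseteq> C"
      by (auto simp: subset.chain_def)
    have "submodule (\<Union>\<C>) R M"
    proof (rule M.submoduleI)
      show "\<Union>\<C> \<subseteq> carrier M" using C submodule_subset by blast
      show "\<zero>\<^bsub>M\<^esub> \<in> \<Union>\<C>" using C ne by blast
      show "\<ominus>\<^bsub>M\<^esub> x \<in> \<Union>\<C>" if "x \<in> \<Union>\<C>" for x
        using that C M.submoduleE(3) by blast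
      show "x \<oplus>\<^bsub>M\<^esub> y \<in> \<Union>\<C>" if x: "x \<in> \<Union>\<C>" and y: "y \<in> \<Union>\<C>" for x y
      proof -
        obtain C D where "C \<in> \<C>" "D \<in> \<C>" "x \<in> C" "y \<in> D" using x y by blast
        then obtain E where "E \<in> \<C>" "x \<in> E" "y \<in> E" using lin by blast
        then show ?thesis using C M.submoduleE(5) by blast
      qed
      show "r \<odot>\<^bsub>M\<^esub> x \<in> \<Union>\<C>" if "r \<in> carrier R" "x \<in> \<Union>\<C>" for r x
        using that C M.submoduleE(4) by blast
    qed
    then show "\<Union>\<C> \<in> ?\<A>" using C ne by blast
  qed
  then obtain C where "C \<in> ?\<A>" "\<forall>X\<in>?\<A>. C \<subseteq> X \<longrightarrow> X = C" by (rule bexE)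
  then have C: "submodule C R M" "K \<subseteq> C" "A \<inter> C = {\<zero>\<^bsub>M\<^esub>}"
    and max: "\<And>X. submodule X R M \<Longrightarrow> K \<subseteq> X \<Longrightarrow> A \<inter> X = {\<zero>\<^bsub>M\<^esub>} \<Longrightarrow> C \<subseteq> X \<Longrightarrow> X = C"
    by simp_all
  note subC = submodule_subset[OF C(1)]
  have zA: "\<zero>\<^bsub>M\<^esub> \<in> A" and zC: "\<zero>\<^bsub>M\<^esub> \<in> C" using C(3) by auto
  have "x \<in> A <+>\<^bsub>M\<^esub> C" if x: "x \<in> carrier M" for x
  proof (cases "x \<in> C")
    case True
    then have "x = \<zero>\<^bsub>M\<^esub> \<oplus>\<^bsub>M\<^esub> x" using x by simp
    then show ?thesis using True zA unfolding set_add_def' by blast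
  next
    case False
    \<comment> \<open>This is C + Rx. It is strictly larger than C, so the maximality of C forces it
      to meet A in a nonzero element.\<close>
    let ?X = "{c \<oplus>\<^bsub>M\<^esub> r \<odot>\<^bsub>M\<^esub> x | c r. c \<in> C \<and> r \<in> carrier R}"
    have X: "submodule ?X R M"
    proof (rule M.submoduleI)
      show "?X \<subseteq> carrier M" using subC x by auto
      show "\<zero>\<^bsub>M\<^esub> \<in> ?X"
        using zC x by (intro CollectI exI[of _ "\<zero>\<^bsub>M\<^esub>"] exI[of _ "\<zero>\<^bsub>R\<^esub>"]) simp
      show "\<ominus>\<^bsub>M\<^esub> y \<in> ?X" if "y \<in> ?X" for y
      proof -
        from that obtain c r where "c \<in> C" "r \<in> carrier R" "y = c \<oplus>\<^bsub>M\<^esub> r \<odot>\<^bsub>M\<^esub> x" by blast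
        then show ?thesis
          using subC x M.submoduleE(3)[OF C(1)]
          by (intro CollectI exI[of _ "\<ominus>\<^bsub>M\<^esub> c"] exI[of _ "\<ominus>\<^bsub>R\<^esub> r"])
            (auto simp: M.minus_add M.smult_l_minus)
      qed
      show "y \<oplus>\<^bsub>M\<^esub> z \<in> ?X" if y: "y \<in> ?X" and z: "z \<in> ?X" for y z
      proof -
        from y obtain c r where cr: "c \<in> C" "r \<in> carrier R" "y = c \<oplus>\<^bsub>M\<^esub> r \<odot>\<^bsub>M\<^esub> x" by blast
        from z obtain d s where ds: "d \<in> C" "s \<in> carrier R" "z = d \<oplus>\<^bsub>M\<^esub> s \<odot>\<^bsub>M\<^esub> x" by blast
        have "c \<in> carrier M" "d \<in> carrier M" using cr ds subC by auto
        then show ?thesis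
          using cr ds x M.submoduleE(5)[OF C(1)]
          by (intro CollectI exI[of _ "c \<oplus>\<^bsub>M\<^esub> d"] exI[of _ "r \<oplus>\<^bsub>R\<^esub> s"])
            (auto simp: M.smult_l_distr M.a_ac)
      qed
      show "t \<odot>\<^bsub>M\<^esub> y \<in> ?X" if "t \<in> carrier R" "y \<in> ?X" for t y
      proof -
        from that obtain c r where "c \<in> C" "r \<in> carrier R" "y = c \<oplus>\<^bsub>M\<^esub> r \<odot>\<^bsub>M\<^esub> x" by blast
        then show ?thesis
          using that(1) subC x M.submoduleE(4)[OF C(1)]
          by (intro CollectI exI[of _ "t \<odot>\<^bsub>M\<^esub> c"] exI[of _ "t \<otimes>\<^bsub>R\<^esub> r"])
            (auto simp: M.smult_r_distr M.smult_assoc1)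
      qed
    qed
    have CX: "C \<subseteq> ?X"
    proof
      fix c assume "c \<in> C"
      then show "c \<in> ?X"
        using subC x by (intro CollectI exI[of _ c] exI[of _ "\<zero>\<^bsub>R\<^esub>"]) auto
    qed
    have "x \<in> ?X" using zC x by (intro CollectI exI[of _ "\<zero>\<^bsub>M\<^esub>"] exI[of _ "\<one>\<^bsub>R\<^esub>"]) simp
    with False max[OF X] CX C(2) have "A \<inter> ?X \<noteq> {\<zero>\<^bsub>M\<^esub>}" by blast
    then obtain a where a: "a \<in> A" "a \<in> ?X" "a \<noteq> \<zero>\<^bsub>M\<^esub>" using zA zC CX by blast
    then obtain c r where cr: "c \<in> C" "r \<in> carrier R" "a = c \<oplus>\<^bsub>M\<^esub> r \<odot>\<^bsub>M\<^esub> x" by blast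
    \<comment> \<open>Otherwise \<open>a\<close> would lie in A \<inter> C. As K \<subseteq> C, it
      follows from \<open>ann\<close> that r does not annihilate A.\<close>
    have "r \<odot>\<^bsub>M\<^esub> x \<notin> C"
      using M.submoduleE(5)[OF C(1) cr(1)] cr(3) a C(3) by blast
    then obtain b where b: "b \<in> A" "r \<odot>\<^bsub>M\<^esub> b \<noteq> \<zero>\<^bsub>M\<^esub>" using ann[OF cr(2) _ x] C(2) by blast
    \<comment> \<open>The nonzero element r b generates A, so s is an inverse of r modulo the
      annihilator of b.\<close>
    obtain s where s: "s \<in> carrier R" "b = s \<odot>\<^bsub>M\<^esub> (r \<odot>\<^bsub>M\<^esub> b)"
      using simple_submodule_generated[OF assms(1,2) _ b(2,1)] M.submoduleE(4)[OF A cr(2) b(1)] by blast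
    \<comment> \<open>The element \<open>1 - s r\<close> kills \<open>b\<close>, which generates \<open>A\<close>, so it maps \<open>x\<close> into \<open>K\<close>.\<close>
    let ?t = "\<one>\<^bsub>R\<^esub> \<ominus>\<^bsub>R\<^esub> s \<otimes>\<^bsub>R\<^esub> r"
    have t: "?t \<in> carrier R" using s cr by simp
    have bM: "b \<in> carrier M" using b subA by auto
    have tz: "?t \<odot>\<^bsub>M\<^esub> z = z \<ominus>\<^bsub>M\<^esub> s \<odot>\<^bsub>M\<^esub> (r \<odot>\<^bsub>M\<^esub> z)" if "z \<in> carrier M" for z
      using that s(1) cr(2)
      by (simp add: a_minus_def M.smult_l_distr M.smult_l_minus M.smult_assoc1)
    have "b \<noteq> \<zero>\<^bsub>M\<^esub>" using b(2) cr(2) by auto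
    have "?t \<odot>\<^bsub>M\<^esub> y = \<zero>\<^bsub>M\<^esub>" if "y \<in> A" for y
    proof -
      obtain u where u: "u \<in> carrier R" "y = u \<odot>\<^bsub>M\<^esub> b"
        using simple_submodule_generated[OF assms(1,2) b(1) \<open>b \<noteq> \<zero>\<^bsub>M\<^esub>\<close> \<open>y \<in> A\<close>] by blast
      have "?t \<odot>\<^bsub>M\<^esub> b = \<zero>\<^bsub>M\<^esub>" using tz[OF bM] s(2) bM by (simp add: a_minus_def M.r_neg)
      moreover have "?t \<odot>\<^bsub>M\<^esub> (u \<odot>\<^bsub>M\<^esub> b) = u \<odot>\<^bsub>M\<^esub> (?t \<odot>\<^bsub>M\<^esub> b)"
        using u(1) t bM by (simp add: M.smult_assoc1[symmetric] M.R.m_comm)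
      ultimately show ?thesis using u by simp
    qed
    then have tx: "?t \<odot>\<^bsub>M\<^esub> x \<in> C" using ann[OF t _ x] C(2) by blast
    \<comment> \<open>Solve for x: x = s r x + t x with t = 1 - s r, and s r x = s a - s c because a
      = c + r x.\<close>
    let ?c = "\<ominus>\<^bsub>M\<^esub> (s \<odot>\<^bsub>M\<^esub> c) \<oplus>\<^bsub>M\<^esub> ?t \<odot>\<^bsub>M\<^esub> x"
    have cM: "c \<in> carrier M" using cr subC by auto
    have "?c \<in> C" using tx cr(1) s(1) M.submoduleE(3-5)[OF C(1)] by blast
    moreover have "s \<odot>\<^bsub>M\<^esub> a \<in> A" using a s M.submoduleE(4)[OF A] by blast
    moreover have "x = s \<odot>\<^bsub>M\<^esub> a \<oplus>\<^bsub>M\<^esub> ?c"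
    proof -
      \<comment> \<open>Used with p = s c and q = s r x, so that p + q = s a and x - q = t
        x.\<close>
      have *: "x = (p \<oplus>\<^bsub>M\<^esub> q) \<oplus>\<^bsub>M\<^esub> (\<ominus>\<^bsub>M\<^esub> p \<oplus>\<^bsub>M\<^esub> (x \<oplus>\<^bsub>M\<^esub> \<ominus>\<^bsub>M\<^esub> q))"
        if "p \<in> carrier M" "q \<in> carrier M" for p q
      proof -
        have "(p \<oplus>\<^bsub>M\<^esub> q) \<oplus>\<^bsub>M\<^esub> (\<ominus>\<^bsub>M\<^esub> p \<oplus>\<^bsub>M\<^esub> (x \<oplus>\<^bsub>M\<^esub> \<ominus>\<^bsub>M\<^esub> q))
            = (p \<oplus>\<^bsub>M\<^esub> \<ominus>\<^bsub>M\<^esub> p) \<oplus>\<^bsub>M\<^esub> ((q \<oplus>\<^bsub>M\<^esub> \<ominus>\<^bsub>M\<^esub> q) \<oplus>\<^bsub>M\<^esub> x)"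
          using that x by (simp only: M.a_ac M.a_inv_closed M.a_closed)
        then show ?thesis using that x by (simp add: M.r_neg)
      qed
      show ?thesis
        using *[of "s \<odot>\<^bsub>M\<^esub> c" "s \<odot>\<^bsub>M\<^esub> (r \<odot>\<^bsub>M\<^esub> x)"] cM cr(2) s(1) x
        unfolding tz[OF x] cr(3) by (simp add: a_minus_def M.smult_r_distr)
    qed
    ultimately show ?thesis unfolding set_add_def' by blast
  qed
  moreover have "A <+>\<^bsub>M\<^esub> C \<subseteq> carrier M" using subA subC by (auto simp: set_add_def')
  ultimately show ?thesis unfolding direct_summand_def using A C by blast
qed

section \<open>Simple summands of a pure submodule and of the whole module\<close>

text \<open>If B complements A in M, then B \<inter> N complements A in N: for x = a + b in N, the
  component b = x - a is again in N since A \<subseteq> N.\<close>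

lemma direct_summand_restrict:
  assumes "module R M" "submodule N R M" "A \<subseteq> N" "direct_summand R M A"
  shows "direct_summand R (M\<lparr>carrier := N\<rparr>) A"
proof -
  interpret M: module R M by fact
  obtain B where A: "submodule A R M" and B: "submodule B R M" "A \<inter> B = {\<zero>\<^bsub>M\<^esub>}"
    "A <+>\<^bsub>M\<^esub> B = carrier M"
    using assms(4) by (auto simp: direct_summand_def)
  note subs = submodule_subset[OF A] submodule_subset[OF B(1)] submodule_subset[OF assms(2)]
  have BN: "submodule (B \<inter> N) R M"
    using M.submoduleE[OF B(1)] M.submoduleE[OF assms(2)] subs B(2) assms(2,3)
    by (intro M.submoduleI) auto
  have "A <+>\<^bsub>M\<^esub> (B \<inter> N) = N"
  proof (intro equalityI subsetI)
    fix x assume "x \<in> A <+>\<^bsub>M\<^esub> (B \<inter> N)"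
    then show "x \<in> N" using M.submoduleE(5)[OF assms(2)] assms(3) by (auto simp: set_add_def')
  next
    fix x assume x: "x \<in> N"
    then have "x \<in> A <+>\<^bsub>M\<^esub> B" using subs B(3) by auto
    then obtain a b where ab: "a \<in> A" "b \<in> B" "x = a \<oplus>\<^bsub>M\<^esub> b" by (auto simp: set_add_def')
    then have "a \<in> carrier M" "b \<in> carrier M" using subs by auto
    with ab have "b = \<ominus>\<^bsub>M\<^esub> a \<oplus>\<^bsub>M\<^esub> x" by (simp add: M.r_neg1)
    then have "b \<in> N"
      using x ab(1) assms(3) M.submoduleE(3,5)[OF assms(2)] by auto
    with ab show "x \<in> A <+>\<^bsub>M\<^esub> (B \<inter> N)" by (auto simp: set_add_def')
  qed
  then show ?thesis
    unfolding direct_summand_def submodule_restrict_iff[OF assms(1,2)]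
    using A BN B(2) assms(3) by (auto intro!: exI[of _ "B \<inter> N"])
qed

text \<open>With N = A + B a direct sum, project N onto A and then map r a \<otimes> y to r y. This
  is well defined on A \<otimes> A because R is commutative and a generates A, so whatever kills a
  kills A. The resulting balanced map on N and A detects a \<otimes> a.\<close>

lemma pure_simple_tensor_square_nonzero:
  assumes M: "module R M" and N: "pure_submodule R M N" and A: "simple_submodule R M A"
    and summand: "direct_summand R (M\<lparr>carrier := N\<rparr>) A"
    and a: "a \<in> A" "frag_of (a, a) \<in> tensor_rel R M (M\<lparr>carrier := A\<rparr>)"
  shows "a = \<zero>\<^bsub>M\<^esub>"
proof (rule ccontr)
  assume a0: "a \<noteq> \<zero>\<^bsub>M\<^esub>"
  interpret M: module R M by fact
  have sN: "submodule N R M" using N by (simp add: pure_submodule_def)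
  have sA: "submodule A R M" using A by (simp add: simple_submodule_def)
  let ?A = "M\<lparr>carrier := A\<rparr>" and ?N = "M\<lparr>carrier := N\<rparr>"
  interpret A: module R ?A using submodule_module[OF M sA] .
  interpret N: module R ?N using submodule_module[OF M sN] .
  obtain B where AN: "A \<subseteq> N" and B: "submodule B R M" "B \<subseteq> N" "A \<inter> B = {\<zero>\<^bsub>M\<^esub>}"
    "A <+>\<^bsub>M\<^esub> B = N"
    using summand by (auto simp: direct_summand_def submodule_restrict_iff[OF M sN])
  have subA: "x \<in> carrier M" if "x \<in> A" for x using that submodule_subset[OF sA] by auto
  have subB: "x \<in> carrier M" if "x \<in> B" for x using that submodule_subset[OF B(1)] by auto
  note clA = M.submoduleE(4,5)[OF sA] and clB = M.submoduleE(4,5)[OF B(1)]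
  have gen: "\<exists>t\<in>carrier R. y = t \<odot>\<^bsub>M\<^esub> a" if "y \<in> A" for y
    using simple_submodule_generated[OF M A a(1) a0 that] by blast
  \<comment> \<open>\<open>P n r\<close> makes r a coordinate of n along a. It is unique only modulo
    the annihilator of a, so \<beta> chooses one; by \<open>uniq\<close> the choice does not affect
    the action on A.\<close>
  define P where "P n r \<longleftrightarrow> r \<in> carrier R \<and> (\<exists>b\<in>B. n = r \<odot>\<^bsub>M\<^esub> a \<oplus>\<^bsub>M\<^esub> b)" for n r
  define \<beta> where "\<beta> n y = (SOME r. P n r) \<odot>\<^bsub>M\<^esub> y" for n y
  have ex: "\<exists>r. P n r" if n: "n \<in> N" for n
  proof -
    from n B(4) obtain x b where "x \<in> A" "b \<in> B" "n = x \<oplus>\<^bsub>M\<^esub> b" by (auto simp: set_add_def')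
    then show ?thesis using gen[of x] by (auto simp: P_def)
  qed
  have uniq: "r \<odot>\<^bsub>M\<^esub> y = s \<odot>\<^bsub>M\<^esub> y" if "P n r" "P n s" "y \<in> A" for n r s y
  proof -
    from that obtain b c where rs: "r \<in> carrier R" "s \<in> carrier R" and bc: "b \<in> B" "c \<in> B"
      and n: "n = r \<odot>\<^bsub>M\<^esub> a \<oplus>\<^bsub>M\<^esub> b" "n = s \<odot>\<^bsub>M\<^esub> a \<oplus>\<^bsub>M\<^esub> c" by (auto simp: P_def)
    let ?p = "r \<odot>\<^bsub>M\<^esub> a" and ?q = "s \<odot>\<^bsub>M\<^esub> a"
    have pq: "?p \<in> A" "?q \<in> A" using clA a(1) rs by auto
    \<comment> \<open>The left side lies in A and the right side in B, so both vanish.\<close>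
    have "?p \<ominus>\<^bsub>M\<^esub> ?q = c \<ominus>\<^bsub>M\<^esub> b"
    proof -
      have "?p = n \<ominus>\<^bsub>M\<^esub> b"
        using subA[OF pq(1)] subB[OF bc(1)] by (simp add: n(1) a_minus_def M.a_assoc M.r_neg)
      also have "\<dots> = ?q \<oplus>\<^bsub>M\<^esub> (c \<ominus>\<^bsub>M\<^esub> b)"
        using subA[OF pq(2)] subB bc by (simp add: n(2) a_minus_def M.a_assoc)
      finally show ?thesis
        using subA[OF pq(2)] subB bc by (simp add: a_minus_def M.a_ac M.r_neg M.r_neg1 M.r_neg2)
    qed
    moreover have "?p \<ominus>\<^bsub>M\<^esub> ?q \<in> A" "c \<ominus>\<^bsub>M\<^esub> b \<in> B"
      using clA(2) clB(2) M.submoduleE(3)[OF sA] M.submoduleE(3)[OF B(1)] pq bc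
      by (simp_all add: a_minus_def)
    ultimately have "?p \<ominus>\<^bsub>M\<^esub> ?q \<in> A \<inter> B" by simp
    then have "?p \<ominus>\<^bsub>M\<^esub> ?q = \<zero>\<^bsub>M\<^esub>" using B(3) by simp
    then have eq: "?p = ?q" using subA pq M.minus_equality[of ?p "\<ominus>\<^bsub>M\<^esub> ?q"] by (simp add: a_minus_def)
    obtain t where t: "t \<in> carrier R" "y = t \<odot>\<^bsub>M\<^esub> a" using gen \<open>y \<in> A\<close> by blast
    have "u \<odot>\<^bsub>M\<^esub> y = t \<odot>\<^bsub>M\<^esub> (u \<odot>\<^bsub>M\<^esub> a)" if "u \<in> carrier R" for u
      using that t subA[OF a(1)] by (simp add: M.smult_assoc1[symmetric] M.R.m_comm)
    then show ?thesis using rs eq by simp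
  qed
  have \<beta>: "\<beta> n y = r \<odot>\<^bsub>M\<^esub> y" if "P n r" "y \<in> A" for n r y
    unfolding \<beta>_def using uniq[OF someI[of "P n", OF that(1)] that] .
  \<comment> \<open>The chosen scalars need not be additive, but sums and multiples of coordinates
    are coordinates, which suffices for \<beta> to be balanced.\<close>
  have P_add: "P (m \<oplus>\<^bsub>M\<^esub> n) (r \<oplus>\<^bsub>R\<^esub> s)" if mr: "P m r" and ns: "P n s" for m n r s
  proof -
    from mr obtain b where b: "r \<in> carrier R" "b \<in> B" "m = r \<odot>\<^bsub>M\<^esub> a \<oplus>\<^bsub>M\<^esub> b" by (auto simp: P_def)
    from ns obtain c where c: "s \<in> carrier R" "c \<in> B" "n = s \<odot>\<^bsub>M\<^esub> a \<oplus>\<^bsub>M\<^esub> c" by (auto simp: P_def)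
    have "m \<oplus>\<^bsub>M\<^esub> n = (r \<oplus>\<^bsub>R\<^esub> s) \<odot>\<^bsub>M\<^esub> a \<oplus>\<^bsub>M\<^esub> (b \<oplus>\<^bsub>M\<^esub> c)"
      using b c subA[OF a(1)] subB by (simp add: M.smult_l_distr M.a_ac)
    then show ?thesis using b c clB(2) by (auto simp: P_def)
  qed
  have P_smult: "P (t \<odot>\<^bsub>M\<^esub> n) (t \<otimes>\<^bsub>R\<^esub> r)" if t: "t \<in> carrier R" and nr: "P n r" for t n r
  proof -
    from nr obtain b where b: "r \<in> carrier R" "b \<in> B" "n = r \<odot>\<^bsub>M\<^esub> a \<oplus>\<^bsub>M\<^esub> b" by (auto simp: P_def)
    have "t \<odot>\<^bsub>M\<^esub> n = (t \<otimes>\<^bsub>R\<^esub> r) \<odot>\<^bsub>M\<^esub> a \<oplus>\<^bsub>M\<^esub> t \<odot>\<^bsub>M\<^esub> b"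
      using t b subA[OF a(1)] subB by (simp add: M.smult_r_distr M.smult_assoc1)
    then show ?thesis using t b clB(1) by (auto simp: P_def)
  qed
  \<comment> \<open>Purity with test module A pulls the relation back from M \<otimes> A to N
    \<otimes> A. As A lives on the type of M, the version for arbitrary types is required.\<close>
  have aa: "frag_of (a, a) \<in> tensor_rel R ?N ?A"
    using pure_submodule_mon[OF M N A.module_axioms] a AN
    by (auto simp: tensor_map_mon_iff[OF M sN A.module_axioms])
  have "\<beta> a a = \<zero>\<^bsub>?A\<^esub>"
  proof (rule tensor_rel_balanced_zero[where \<beta> = \<beta> and x = a and l = a, OF N.module_axioms A.module_axioms
        A.M.abelian_group_axioms])
    fix x l assume x: "x \<in> carrier ?N" and l: "l \<in> carrier ?A"
    then obtain r where r: "P x r" using ex by auto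
    then have rR: "r \<in> carrier R" by (simp add: P_def)
    have lA: "l \<in> A" using l by simp
    show "\<beta> x l \<in> carrier ?A" using \<beta>[OF r lA] clA(1) rR lA by simp
    show "\<beta> (x \<oplus>\<^bsub>?N\<^esub> y) l = \<beta> x l \<oplus>\<^bsub>?A\<^esub> \<beta> y l" if "y \<in> carrier ?N" for y
    proof -
      from that obtain s where s: "P y s" using ex by auto
      then have "s \<in> carrier R" by (simp add: P_def)
      then show ?thesis
        using \<beta>[OF r lA] \<beta>[OF s lA] \<beta>[OF P_add[OF r s] lA] rR subA[OF lA]
        by (simp add: M.smult_l_distr)
    qed
    show "\<beta> x (l \<oplus>\<^bsub>?A\<^esub> k) = \<beta> x l \<oplus>\<^bsub>?A\<^esub> \<beta> x k" if "k \<in> carrier ?A" for k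
    proof -
      have kA: "k \<in> A" using that by simp
      show ?thesis
        using \<beta>[OF r lA] \<beta>[OF r kA] \<beta>[OF r clA(2)[OF lA kA]] rR subA[OF lA] subA[OF kA]
        by (simp add: M.smult_r_distr)
    qed
    show "\<beta> (t \<odot>\<^bsub>?N\<^esub> x) l = \<beta> x (t \<odot>\<^bsub>?A\<^esub> l)" if t: "t \<in> carrier R" for t
      using \<beta>[OF P_smult[OF t r] lA] \<beta>[OF r clA(1)[OF t lA]] t rR subA[OF lA]
      by (simp add: M.smult_assoc1[symmetric] M.R.m_comm)
  qed (use a AN aa in auto)
  \<comment> \<open>The element a has coordinate 1 and B-component 0, so \<beta> sends (a, a) to a
    itself.\<close>
  moreover have "P a \<one>\<^bsub>R\<^esub>"
    unfolding P_def using subA[OF a(1)] B(3) by (auto intro!: bexI[of _ "\<zero>\<^bsub>M\<^esub>"])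
  ultimately show False using \<beta>[of a "\<one>\<^bsub>R\<^esub>" a] a subA a0 by simp
qed

lemma direct_summand_of_pure:
  assumes M: "module R M" and N: "pure_submodule R M N" and A: "simple_submodule R M A"
    and summand: "direct_summand R (M\<lparr>carrier := N\<rparr>) A"
  shows "direct_summand R M A"
proof -
  interpret M: module R M by fact
  have sA: "submodule A R M" using A by (simp add: simple_submodule_def)
  note mA = submodule_module[OF M sA]
  note clA = M.submoduleE(4,5)[OF sA]
  have subA: "x \<in> carrier M" if "x \<in> A" for x using that submodule_subset[OF sA] by auto
  have zA: "\<zero>\<^bsub>M\<^esub> \<in> A" using subgroup.one_closed[OF submodule.axioms(1)[OF sA]] by simp
  let ?T = "tensor_rel R M (M\<lparr>carrier := A\<rparr>)"
  \<comment> \<open>The kernel of the canonical map from M to Hom(A, M \<otimes> A).\<close>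
  let ?K = "{x \<in> carrier M. \<forall>l\<in>A. frag_of (x, l) \<in> ?T}"
  \<comment> \<open>The relator for 0 + 0 = 0 collapses to the negative of this generator.\<close>
  have tzero: "frag_of (x, \<zero>\<^bsub>M\<^esub>) \<in> ?T" if "x \<in> carrier M" for x
    using tensor_rel_minus[OF M mA tensor_rel_relator[OF tensor_relators_intros(2)[of x M "\<zero>\<^bsub>M\<^esub>" _ "\<zero>\<^bsub>M\<^esub>"]]]
      that zA by simp
  have tsmult: "frag_of (r \<odot>\<^bsub>M\<^esub> x, l) \<in> ?T"
    if "r \<in> carrier R" "x \<in> carrier M" "l \<in> A" "frag_of (x, r \<odot>\<^bsub>M\<^esub> l) \<in> ?T" for r x l
    using tensor_rel_add[OF M mA tensor_rel_relator[OF tensor_relators_intros(3)[of r R x M l]]] that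
    by force
  \<comment> \<open>Moving the scalar across gives r x \<otimes> l = x \<otimes> r l = x \<otimes> 0
    = 0.\<close>
  have ann: "r \<odot>\<^bsub>M\<^esub> x \<in> ?K"
    if "r \<in> carrier R" "\<And>a. a \<in> A \<Longrightarrow> r \<odot>\<^bsub>M\<^esub> a = \<zero>\<^bsub>M\<^esub>" "x \<in> carrier M" for r x
    using that tsmult tzero by simp
  have smultK: "r \<odot>\<^bsub>M\<^esub> x \<in> ?K" if "r \<in> carrier R" "x \<in> ?K" for r x
    using that tsmult clA(1) by simp
  have K: "submodule ?K R M"
  proof (rule M.submoduleI)
    show "\<zero>\<^bsub>M\<^esub> \<in> ?K" using ann[of "\<zero>\<^bsub>R\<^esub>" "\<zero>\<^bsub>M\<^esub>"] subA by simp
    show "\<ominus>\<^bsub>M\<^esub> x \<in> ?K" if "x \<in> ?K" for x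
      using smultK[of "\<ominus>\<^bsub>R\<^esub> \<one>\<^bsub>R\<^esub>" x] that by (simp add: M.smult_l_minus)
    show "x \<oplus>\<^bsub>M\<^esub> y \<in> ?K" if "x \<in> ?K" "y \<in> ?K" for x y
    proof -
      have "frag_of (x \<oplus>\<^bsub>M\<^esub> y, l) \<in> ?T" if l: "l \<in> A" for l
      proof -
        have "frag_of (x \<oplus>\<^bsub>M\<^esub> y, l) - frag_of (x, l) - frag_of (y, l) \<in> ?T"
          using \<open>x \<in> ?K\<close> \<open>y \<in> ?K\<close> l by (intro tensor_rel_relator tensor_relators_intros) auto
        moreover have "frag_of (x, l) + frag_of (y, l) \<in> ?T"
          using \<open>x \<in> ?K\<close> \<open>y \<in> ?K\<close> l by (intro tensor_rel_add[OF M mA]) auto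
        ultimately show ?thesis using tensor_rel_add[OF M mA] by fastforce
      qed
      then show ?thesis using that by simp
    qed
  qed (use smultK in auto)
  have "\<zero>\<^bsub>M\<^esub> \<in> ?K" using ann[of "\<zero>\<^bsub>R\<^esub>" "\<zero>\<^bsub>M\<^esub>"] subA by simp
  moreover have "a = \<zero>\<^bsub>M\<^esub>" if "a \<in> A" "a \<in> ?K" for a
    using pure_simple_tensor_square_nonzero[OF assms that(1)] that by blast
  ultimately have "A \<inter> ?K = {\<zero>\<^bsub>M\<^esub>}" using zA by blast
  then show ?thesis using direct_summand_if_avoids[OF M A K] ann by blast
qed

section \<open>The socle and simple-direct-injectivity\<close>

lemma simple_submodule_le_socle:
  assumes "module R M" "simple_submodule R M A"
  shows "A \<subseteq> socle R M"
proof
  interpret M: module R M by fact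
  fix a assume a: "a \<in> A"
  then have "a \<in> carrier M" using assms(2) submodule_subset by (auto simp: simple_submodule_def)
  then have "a = finsum M (\<lambda>_. a) {A}" by simp
  then show "a \<in> socle R M" using assms(2) a unfolding socle_def by blast
qed

theorem lemma5:
  fixes R :: "('r, 'x) ring_scheme" and M :: "('r, 'm, 'y) module_scheme" and N :: "'m set"
  assumes "module R M"
    and "pure_submodule R M N"
  shows "(simple_direct_injective R M \<longrightarrow> simple_direct_injective R (M\<lparr>carrier := N\<rparr>)) \<and>
         (socle R M \<subseteq> N \<and> simple_direct_injective R (M\<lparr>carrier := N\<rparr>)
           \<longrightarrow> simple_direct_injective R M)"
proof -
  have N: "submodule N R M" using assms(2) by (simp add: pure_submodule_def)
  have summand: "direct_summand R (M\<lparr>carrier := N\<rparr>) A \<longleftrightarrow> direct_summand R M A"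
    if "simple_submodule R M A" "A \<subseteq> N" for A
    using that direct_summand_restrict[OF assms(1) N] direct_summand_of_pure[OF assms] by blast
  \<comment> \<open>By \<open>summand\<close>, the condition for N is the condition for M restricted
    to pairs inside N. This gives the first implication at once.\<close>
  have sdi: "simple_direct_injective R (M\<lparr>carrier := N\<rparr>) \<longleftrightarrow>
      (\<forall>A B. simple_submodule R M A \<and> A \<subseteq> N \<and> simple_submodule R M B \<and> B \<subseteq> N \<and>
        mod_isomorphic R (M\<lparr>carrier := A\<rparr>) (M\<lparr>carrier := B\<rparr>) \<and> direct_summand R M B
        \<longrightarrow> direct_summand R M A)"
    by (simp add: simple_direct_injective_def simple_submodule_restrict_iff[OF assms(1) N])
      (metis summand)
  \<comment> \<open>When N contains the socle, the restriction to submodules of N excludes nothing,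
    which gives the converse.\<close>
  have "A \<subseteq> N" if "socle R M \<subseteq> N" "simple_submodule R M A" for A
    using simple_submodule_le_socle[OF assms(1) that(2)] that(1) by blast
  then show ?thesis unfolding sdi unfolding simple_direct_injective_def by (intro conjI impI) metis+
qed

end
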